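(* Every non-principal ultrafilter on $\mathbb{N}$ that is a P-point is a quasi P-point.
   Context: A non-principal ultrafilter $\alpha$ on $\mathbb{N}$ is a P-point if for every partition $\{A_n:n\in\mathbb{N}\}$ of $\mathbb{N}$ with $A_n\notin\alpha$ for all $n$, there is $X\in\alpha$ such that $X\cap A_n$ is finite for each $n\in\mathbb{N}$. Quasi P-points: "$A_n\downarrow\emptyset$ in $\alpha$" means that $(A_n)_{n\in\mathbb{N}}$ is a decreasing sequence of members of $\alpha$ with $\bigcap_nA_n=\emptyset$. Let $\mathscr{D}$ be the diagonal of $\mathbb{N}^2$. Uniformities are understood to be separated (the intersection of all entourages is $\mathscr{D}$), so that a uniformity with a countable base is induced by a metric. A non-principal ultrafilter $\alpha$ on $\mathbb{N}$ is a quasi P-point if for every countable decreasing base $(\mathscr{E}_k)_{k\in\mathbb{N}}$ of a uniformity on $\mathbb{N}$ at least one of the following holds: (i) there exist $X\in\alpha$ and $k\in\mathbb{N}$ such that $(X^2\cap\mathscr{E}_k)\setminus\mathscr{D}=\emptyset$; (ii) for every $k\in\mathbb{N}$ there exists $X\in\alpha$ such that $X^2\subset\mathscr{E}_k$; (iii) for every $A_n\downarrow\emptyset$ in $\alpha$ and every $k\in\mathbb{N}$ there exists $X\in\alpha$ such that for every $n\in\mathbb{N}$ the set $\{i\in X:\exists j\in A_n \text{ with }(i,j)\in\mathscr{E}_k\}$ is cofinite in $X$. *)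

theory Defs
  imports Complex_Main "HOL-Library.Disjoint_Sets"
begin

text \<open>Filters are those of the library type \<open>'a filter\<close>, so that a set \<open>A\<close> is a member
  of a filter \<open>F\<close> iff the predicate \<open>\<lambda>x. x \<in> A\<close> holds eventually along \<open>F\<close>.\<close>

abbreviation mem_filter :: "'a set \<Rightarrow> 'a filter \<Rightarrow> bool"  (infix "\<in>\<^sub>F" 50) where
  "A \<in>\<^sub>F F \<equiv> eventually (\<lambda>x. x \<in> A) F"

definition ultrafilter :: "'a filter \<Rightarrow> bool" where
  "ultrafilter F \<longleftrightarrow> F \<noteq> bot \<and> (\<forall>A. A \<in>\<^sub>F F \<or> (- A) \<in>\<^sub>F F)"

definition nonprincipal_ultrafilter :: "'a filter \<Rightarrow> bool" where
  "nonprincipal_ultrafilter F \<longleftrightarrow> ultrafilter F \<and> (\<forall>x. F \<noteq> principal {x})"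

text \<open>The sequence \<open>A\<close> may repeat sets, so finite partitions are allowed; only the set
  \<open>range A\<close> has to be a partition.\<close>

definition P_point :: "nat filter \<Rightarrow> bool" where
  "P_point \<alpha> \<longleftrightarrow> nonprincipal_ultrafilter \<alpha> \<and>
     (\<forall>A :: nat \<Rightarrow> nat set. partition_on UNIV (range A) \<and> (\<forall>n. \<not> A n \<in>\<^sub>F \<alpha>) \<longrightarrow>
        (\<exists>X. X \<in>\<^sub>F \<alpha> \<and> (\<forall>n. finite (X \<inter> A n))))"

text \<open>A uniformity on the type \<open>'a\<close> as a filter of entourages, with the axioms of the class
  \<open>uniform_space\<close> (which attaches one fixed uniformity to a type) and separation.\<close>

definition separated_uniformity :: "('a \<times> 'a) filter \<Rightarrow> bool" where
  "separated_uniformity U \<longleftrightarrow>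
     (\<forall>E. E \<in>\<^sub>F U \<longrightarrow> Id \<subseteq> E) \<and>
     (\<forall>E. E \<in>\<^sub>F U \<longrightarrow> E\<inverse> \<in>\<^sub>F U) \<and>
     (\<forall>E. E \<in>\<^sub>F U \<longrightarrow> (\<exists>D. D \<in>\<^sub>F U \<and> D O D \<subseteq> E)) \<and>
     \<Inter> {E. E \<in>\<^sub>F U} = Id"

text \<open>Members of a base need not be symmetric relations.\<close>

definition decreasing_base :: "(nat \<Rightarrow> 'a set) \<Rightarrow> 'a filter \<Rightarrow> bool" where
  "decreasing_base E U \<longleftrightarrow>
     decseq E \<and> (\<forall>k. E k \<in>\<^sub>F U) \<and> (\<forall>S. S \<in>\<^sub>F U \<longrightarrow> (\<exists>k. E k \<subseteq> S))"

definition decreases_to_empty_in :: "(nat \<Rightarrow> 'a set) \<Rightarrow> 'a filter \<Rightarrow> bool" where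
  "decreases_to_empty_in A F \<longleftrightarrow> decseq A \<and> (\<forall>n. A n \<in>\<^sub>F F) \<and> (\<Inter>n. A n) = {}"

definition quasi_P_point :: "nat filter \<Rightarrow> bool" where
  "quasi_P_point \<alpha> \<longleftrightarrow> nonprincipal_ultrafilter \<alpha> \<and>
     (\<forall>(U :: (nat \<times> nat) filter) E. separated_uniformity U \<and> decreasing_base E U \<longrightarrow>
        (\<exists>X k. X \<in>\<^sub>F \<alpha> \<and> (X \<times> X \<inter> E k) - Id = {}) \<or>
        (\<forall>k. \<exists>X. X \<in>\<^sub>F \<alpha> \<and> X \<times> X \<subseteq> E k) \<or>
        (\<forall>A k. decreases_to_empty_in A \<alpha> \<longrightarrow>
           (\<exists>X. X \<in>\<^sub>F \<alpha> \<and>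
              (\<forall>n. finite (X - {i \<in> X. \<exists>j \<in> A n. (i, j) \<in> E k})))))"

end

theory Submission
  imports Defs
begin

text \<open>Of the three alternatives for a quasi P-point, a P-point always satisfies the last. By
  \<open>P_point_pseudointersection\<close>, some member of \<alpha> is almost contained in every
  \<open>A n\<close>, and enlarging \<open>A n\<close> by an entourage loses no points.\<close>

lemma ultrafilter_Int_nonempty:
  assumes "ultrafilter F" "A \<in>\<^sub>F F" "B \<in>\<^sub>F F"
  shows "A \<inter> B \<noteq> {}"
proof
  assume "A \<inter> B = {}"
  then have "eventually (\<lambda>x. False) F"
    using eventually_conj[OF assms(2,3)] by (auto elim: eventually_mono)
  then show False
    using assms(1) by (simp add: ultrafilter_def trivial_limit_def)
qed

text \<open>Partition the naturals by the first index at which a point leaves the sequence and apply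
  the P-point property: a set meeting each block finitely has only finitely many points that have
  left by stage \<open>n\<close>.\<close>

lemma P_point_pseudointersection:
  assumes "P_point \<alpha>" and A: "decreases_to_empty_in A \<alpha>"
  obtains X where "X \<in>\<^sub>F \<alpha>" "\<And>n. finite (X - A n)"
proof -
  have dec: "decseq A" and mem: "\<And>n. A n \<in>\<^sub>F \<alpha>" and empty: "(\<Inter>n. A n) = {}"
    using A by (auto simp: decreases_to_empty_in_def)
  have ultra: "ultrafilter \<alpha>"
    using assms(1) by (simp add: P_point_def nonprincipal_ultrafilter_def)
  define f where "f x = (LEAST n. x \<notin> A n)" for x
  have f: "x \<notin> A (f x)" for x
    unfolding f_def by (rule LeastI_ex) (use empty in auto)
  have f_le: "f x \<le> n" if "x \<notin> A n" for x n
    unfolding f_def using that by (rule Least_le)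
  \<comment> \<open>Indexing the fibres of \<open>f\<close> by points rather than by values keeps every block nonempty.\<close>
  define C where "C n = {x. f x = f n}" for n
  have "partition_on UNIV (range C)"
    by (rule partition_onI) (auto simp: C_def disjnt_def)
  moreover have "\<not> C n \<in>\<^sub>F \<alpha>" for n
  proof
    \<comment> \<open>All points of \<open>C n\<close> leave the sequence at index
      \<open>f n\<close>, so this block misses the member \<open>A (f n)\<close> of
      \<alpha>.\<close>
    assume "C n \<in>\<^sub>F \<alpha>"
    then obtain x where "x \<in> C n" "x \<in> A (f n)"
      using ultrafilter_Int_nonempty[OF ultra _ mem] by blast
    then show False
      using f[of x] by (simp add: C_def)
  qed
  ultimately obtain X where X: "X \<in>\<^sub>F \<alpha>" and fin: "\<And>n. finite (X \<inter> C n)"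
    using assms(1) unfolding P_point_def by blast
  have "finite (X \<inter> {x. f x = m})" for m
  proof (cases "\<exists>n. f n = m")
    case True
    then show ?thesis using fin by (auto simp: C_def)
  qed auto
  then have "finite (\<Union>m\<le>n. X \<inter> {x. f x = m})" for n
    by blast
  moreover have "X - A n \<subseteq> (\<Union>m\<le>n. X \<inter> {x. f x = m})" for n
    using f_le by auto
  ultimately have "finite (X - A n)" for n
    using finite_subset by blast
  with X show thesis by (rule that)
qed

text \<open>Clause (iii) holds for every uniformity: entourages are reflexive, so it is enough to
  find a pseudointersection of the sequence \<open>A\<close> in the ultrafilter.\<close>

theorem corollary7:
  fixes \<alpha> :: "nat filter"
  assumes "nonprincipal_ultrafilter \<alpha>"
    and "P_point \<alpha>"
  shows "quasi_P_point \<alpha>"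
proof -
  have "\<exists>X. X \<in>\<^sub>F \<alpha> \<and> (\<forall>n. finite (X - {i \<in> X. \<exists>j \<in> A n. (i, j) \<in> E k}))"
    if U: "separated_uniformity U" "decreasing_base E U" and A: "decreases_to_empty_in A \<alpha>"
    for U E A and k :: nat
  proof -
    obtain X where X: "X \<in>\<^sub>F \<alpha>" "\<And>n. finite (X - A n)"
      using P_point_pseudointersection[OF assms(2) A] by blast
    have "Id \<subseteq> E k"
      using U by (simp add: separated_uniformity_def decreasing_base_def)
    \<comment> \<open>Each \<open>i\<close> in \<open>A n\<close> is its own witness
      \<open>j\<close>.\<close>
    then have "X - {i \<in> X. \<exists>j \<in> A n. (i, j) \<in> E k} \<subseteq> X - A n" for n
      by auto
    with X show ?thesis
      by (meson finite_subset)
  qed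
  with assms(1) show ?thesis
    unfolding quasi_P_point_def by blast
qed

end
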